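(* The time integration methods SI1(1) and SI1(2) are $L$-stable. Explicitly, let $$R_{\mathrm{SI1(1)}}(z)=\frac{1+\mathrm{i}z_{\mathrm i}}{1-z_{\mathrm r}+\tfrac12 z_{\mathrm i}^2},\qquad R_{\mathrm{SI1(2)}}(z)=\frac{1+\mathrm{i}z_{\mathrm i}\,R_{\mathrm{SI1(1)}}(z)}{1-z_{\mathrm r}+\tfrac12 z_{\mathrm i}^2},\qquad z=z_{\mathrm r}+\mathrm{i}z_{\mathrm i}\in\mathbb C,\ z_{\mathrm r},z_{\mathrm i}\in\mathbb R,$$ be the stability functions of SI1(1) and SI1(2). Then for each $R\in\{R_{\mathrm{SI1(1)}},R_{\mathrm{SI1(2)}}\}$: $|R(z)|\le 1$ for all $z\in\mathbb C$ with $z_{\mathrm r}\le 0$, and $R(z)\to 0$ as $|z|\to\infty$ with $z_{\mathrm r}\le 0$.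
   Context: Linear stability is studied for the Dahlquist equation $\frac{\mathrm d\hat u}{\mathrm dt}=\lambda\hat u$, $\lambda=\lambda_{\mathrm r}+\mathrm i\lambda_{\mathrm i}\in\mathbb C$ (with $\lambda_{\mathrm r},\lambda_{\mathrm i}\in\mathbb R$), which arises from the convection-diffusion equation $\partial_t u=-\partial_x(vu)+\partial_x(\nu\,\partial_x u)$ with constant $v$ and $\nu\ge 0$ by inserting $u=\hat u(t)\mathrm e^{\mathrm i kx}$, so that $\lambda_{\mathrm r}=-\nu k^2$ and $\lambda_{\mathrm i}=-vk$. The right-hand side is treated through an explicit part $\hat\phi_{\mathrm{ex}}(\hat u)=\mathrm i\lambda_{\mathrm i}\hat u$ and an implicit part $\hat\phi_{\mathrm{im}}(\hat u,\theta)=\bigl(\lambda_{\mathrm r}-\tfrac{\theta}{2}\lambda_{\mathrm i}^2\bigr)\hat u$. With time step $\Delta t>0$, the methods applied to this equation are: SI1(1): $\hat u^{n+1}=\hat u^n+\Delta t\,[\hat\phi_{\mathrm{ex}}(\hat u^n)+\hat\phi_{\mathrm{im}}(\hat u^{n+1},\Delta t)]$. SI1(2): $\hat u^{(1)}=\hat u^n+\Delta t\,[\hat\phi_{\mathrm{ex}}(\hat u^n)+\hat\phi_{\mathrm{im}}(\hat u^{(1)},\Delta t)]$, $\ \hat u^{(2)}=\hat u^n+\Delta t\,[\hat\phi_{\mathrm{ex}}(\hat u^{(1)})+\hat\phi_{\mathrm{im}}(\hat u^{(2)},\Delta t)]$, $\ \hat u^{n+1}=\hat u^{(2)}$. The stability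 function of a one-step method is $R(z)=\hat u^{n+1}/\hat u^n$ with $z=\Delta t\,\lambda=z_{\mathrm r}+\mathrm i z_{\mathrm i}$; for SI1(1) and SI1(2) this gives the functions stated in the claim. A method is $A$-stable if $|R(z)|\le 1$ for all $z$ with $z_{\mathrm r}\le 0$, and $L$-stable if in addition $R(z)\to 0$ as $z\to\infty$ (within $z_{\mathrm r}\le 0$). Note that $R$ is a function of the two real variables $z_{\mathrm r},z_{\mathrm i}$ and is not holomorphic in $z$. *)

theory Defs
  imports Complex_Main
begin

definition phi_ex :: "complex \<Rightarrow> complex \<Rightarrow> complex" where
  "phi_ex lam u = \<i> * of_real (Im lam) * u"

definition phi_im :: "complex \<Rightarrow> complex \<Rightarrow> real \<Rightarrow> complex" where
  "phi_im lam u \<theta> = of_real (Re lam - \<theta> / 2 * (Im lam)\<^sup>2) * u"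

text \<open>The schemes are implicit, so a one-step method for the Dahlquist equation
  \<open>du/dt = lam * u\<close> is a relation: \<open>M dt lam u u'\<close> says that \<open>u'\<close> is an admissible
  value after one step of size \<open>dt\<close> from \<open>u\<close>.\<close>

type_synonym one_step_method = "real \<Rightarrow> complex \<Rightarrow> complex \<Rightarrow> complex \<Rightarrow> bool"

definition SI1_1 :: one_step_method where
  "SI1_1 dt lam u u' \<longleftrightarrow> u' = u + of_real dt * (phi_ex lam u + phi_im lam u' dt)"

definition SI1_2 :: one_step_method where
  "SI1_2 dt lam u u' \<longleftrightarrow>
     (\<exists>u1 u2. u1 = u + of_real dt * (phi_ex lam u + phi_im lam u1 dt) \<and>
              u2 = u + of_real dt * (phi_ex lam u1 + phi_im lam u2 dt) \<and>
              u' = u2)"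

text \<open>\<open>R\<close> is the quotient of successive values, as a function of \<open>z = dt * lam\<close>. Steps are
  required to exist on the closed left half-plane; for \<open>Re lam > 0\<close> the
  implicit equations can be unsolvable, and there \<open>R\<close> is constrained only where a step
  exists.\<close>

definition is_stability_function :: "one_step_method \<Rightarrow> (complex \<Rightarrow> complex) \<Rightarrow> bool" where
  "is_stability_function M R \<longleftrightarrow>
     (\<forall>dt>0. \<forall>lam u. u \<noteq> 0 \<longrightarrow>
        (Re lam \<le> 0 \<longrightarrow> (\<exists>u'. M dt lam u u')) \<and>
        (\<forall>u'. M dt lam u u' \<longrightarrow> R (of_real dt * lam) = u' / u))"

definition A_stable :: "(complex \<Rightarrow> complex) \<Rightarrow> bool" where
  "A_stable R \<longleftrightarrow> (\<forall>z. Re z \<le> 0 \<longrightarrow> cmod (R z) \<le> 1)"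

definition L_stable :: "(complex \<Rightarrow> complex) \<Rightarrow> bool" where
  "L_stable R \<longleftrightarrow> A_stable R \<and> (R \<longlongrightarrow> 0) (inf at_infinity (principal {z. Re z \<le> 0}))"

definition R_SI1_1 :: "complex \<Rightarrow> complex" where
  "R_SI1_1 z = (1 + \<i> * of_real (Im z)) / of_real (1 - Re z + 1 / 2 * (Im z)\<^sup>2)"

definition R_SI1_2 :: "complex \<Rightarrow> complex" where
  "R_SI1_2 z = (1 + \<i> * of_real (Im z) * R_SI1_1 z) / of_real (1 - Re z + 1 / 2 * (Im z)\<^sup>2)"

end

theory Submission
  imports Defs
begin

text \<open>Write \<open>z = x + iy\<close> with \<open>x \<le> 0\<close> and \<open>D = 1 - x + y\<^sup>2/2\<close>. Each stage divides by \<open>D\<close>, and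
  \<open>D \<ge> 1 + y\<^sup>2/2\<close>, \<open>D \<ge> |z|\<close>. For SI1(1), \<open>|1 + iy|\<^sup>2 = 1 + y\<^sup>2\<close> is at most \<open>D\<^sup>2\<close> and at most
  \<open>2D\<close>, so \<open>|R| \<le> 1\<close> and \<open>|R|\<^sup>2 \<le> 2/|z|\<close>. For SI1(2) the numerator is
  \<open>(1 - y\<^sup>2/D) + iy/D\<close>, whose modulus is at most \<open>1\<close> because \<open>y\<^sup>2 + y\<^sup>4 \<le> 2y\<^sup>2 D\<close>; hence
  \<open>|R| \<le> 1/D\<close>.\<close>

definition stage_denom :: "complex \<Rightarrow> real" where
  "stage_denom z = 1 - Re z + 1 / 2 * (Im z)\<^sup>2"

lemma stage_denom_ge:
  assumes "Re z \<le> 0"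
  shows "stage_denom z \<ge> 1 + (Im z)\<^sup>2 / 2" "stage_denom z \<ge> 1" "stage_denom z \<ge> cmod z"
proof -
  show ge: "stage_denom z \<ge> 1 + (Im z)\<^sup>2 / 2"
    using assms by (simp add: stage_denom_def)
  then show "stage_denom z \<ge> 1"
    using zero_le_power2[of "Im z"] by linarith
  \<comment> \<open>This square controls the imaginary part by the quadratic term of
    \<open>stage_denom\<close>. The real part needs no such estimate, since \<open>- Re z\<close> is
    \<open>\<bar>Re z\<bar>\<close> here.\<close>
  have "(\<bar>Im z\<bar> - 1)\<^sup>2 \<ge> 0" by simp
  then have "\<bar>Im z\<bar> \<le> 1 + (Im z)\<^sup>2 / 2"
    by (simp add: power2_diff)
  then show "stage_denom z \<ge> cmod z"
    using cmod_le[of z] assms by (simp add: stage_denom_def)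
qed

text \<open>Every stage of both methods has this shape, with explicit argument \<open>w\<close> and
  unknown \<open>v\<close>. Moving the implicit term to the left and using
  \<open>\<theta> = dt\<close> makes the coefficient of \<open>v\<close> depend on
  \<open>dt * lam\<close> only.\<close>

lemma stage_eq_iff:
  "v = u + of_real dt * (phi_ex lam w + phi_im lam v dt) \<longleftrightarrow>
   of_real (stage_denom (of_real dt * lam)) * v = u + \<i> * of_real (Im (of_real dt * lam)) * w"
  by (auto simp: stage_denom_def phi_ex_def phi_im_def algebra_simps power2_eq_square)

lemma stage_numerator_nonzero: "1 + \<i> * complex_of_real y \<noteq> 0"
  by (simp add: complex_eq_iff)

lemma stability_function_SI1_1: "is_stability_function SI1_1 R_SI1_1"
  unfolding is_stability_function_def
proof (intro allI impI conjI)
  fix dt :: real and lam u :: complex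
  assume dt: "dt > 0" and u: "u \<noteq> 0"
  let ?z = "of_real dt * lam"
  let ?d = "complex_of_real (stage_denom ?z)"
  let ?n = "1 + \<i> * of_real (Im ?z)"
  have step: "SI1_1 dt lam u u' \<longleftrightarrow> ?d * u' = ?n * u" for u'
    unfolding SI1_1_def stage_eq_iff by (simp add: algebra_simps)
  {
    assume "Re lam \<le> 0"
    then have "?d \<noteq> 0"
      using dt stage_denom_ge(2)[of ?z] by (auto simp: mult_le_0_iff)
    then have "SI1_1 dt lam u (?n * u / ?d)"
      unfolding step by simp
    then show "\<exists>u'. SI1_1 dt lam u u'" ..
  next
    fix u'
    assume "SI1_1 dt lam u u'"
    then have eq: "?d * u' = ?n * u"
      unfolding step .
    \<comment> \<open>For \<open>Re lam > 0\<close> the denominator can vanish, so its sign is no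
      argument here. The existence of a step is: \<open>?d = 0\<close> would force
      \<open>?n * u = 0\<close>.\<close>
    then have "?d \<noteq> 0"
      using u stage_numerator_nonzero[of "Im ?z"] by auto
    then show "R_SI1_1 ?z = u' / u"
      using eq u unfolding R_SI1_1_def stage_denom_def[symmetric]
      by (simp add: frac_eq_eq mult.commute)
  }
qed

text \<open>The first stage is a step of \<open>SI1_1\<close>, so \<open>u1 / u\<close> is already
  known to be \<open>R_SI1_1\<close>. Dividing the second stage equation by \<open>u\<close> then
  gives the nested formula.\<close>

lemma stability_function_SI1_2: "is_stability_function SI1_2 R_SI1_2"
  unfolding is_stability_function_def
proof (intro allI impI conjI)
  fix dt :: real and lam u :: complex
  assume dt: "dt > 0" and u: "u \<noteq> 0"
  let ?z = "of_real dt * lam"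
  let ?d = "complex_of_real (stage_denom ?z)"
  let ?y = "\<i> * of_real (Im ?z)"
  have step: "SI1_2 dt lam u u' \<longleftrightarrow> (\<exists>u1. SI1_1 dt lam u u1 \<and> ?d * u' = u + ?y * u1)" for u'
    unfolding SI1_2_def SI1_1_def by (simp only: stage_eq_iff) blast
  {
    assume lam: "Re lam \<le> 0"
    obtain u1 where "SI1_1 dt lam u u1"
      using stability_function_SI1_1 dt u lam unfolding is_stability_function_def by blast
    moreover have "?d \<noteq> 0"
      using dt lam stage_denom_ge(2)[of ?z] by (auto simp: mult_le_0_iff)
    ultimately have "SI1_2 dt lam u ((u + ?y * u1) / ?d)"
      unfolding step by auto
    then show "\<exists>u'. SI1_2 dt lam u u'" ..
  next
    fix u'
    assume "SI1_2 dt lam u u'"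
    then obtain u1 where u1: "SI1_1 dt lam u u1" and eq: "?d * u' = u + ?y * u1"
      unfolding step by blast
    have R1: "R_SI1_1 ?z = u1 / u"
      using stability_function_SI1_1 dt u u1 unfolding is_stability_function_def by blast
    have "?d * u1 = (1 + ?y) * u"
      using u1 unfolding SI1_1_def stage_eq_iff by (simp add: algebra_simps)
    then have "?d \<noteq> 0"
      using u stage_numerator_nonzero[of "Im ?z"] by auto
    moreover have "1 + ?y * (u1 / u) = ?d * u' / u"
      unfolding eq using u by (simp add: field_simps)
    ultimately show "R_SI1_2 ?z = u' / u"
      unfolding R_SI1_2_def stage_denom_def[symmetric] R1 by simp
  }
qed

text \<open>As \<open>stage_denom z\<close> dominates \<open>cmod z\<close>, a bound in terms of it
  gives decay uniformly in direction. The modulus is squared because \<open>R_SI1_1\<close> decays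
  only like \<open>1 / sqrt (cmod z)\<close> where \<open>- Re z\<close> is comparable to
  \<open>(Im z)\<^sup>2\<close>.\<close>

lemma L_stableI:
  assumes "\<And>z. Re z \<le> 0 \<Longrightarrow> cmod (R z) \<le> 1"
    and bound: "\<And>z. Re z \<le> 0 \<Longrightarrow> (cmod (R z))\<^sup>2 \<le> 2 / stage_denom z"
  shows "L_stable R"
proof -
  let ?F = "inf at_infinity (principal {z. Re z \<le> 0})"
  have "filterlim cmod at_top ?F"
    using filterlim_norm_at_top by (rule filterlim_mono) simp_all
  then have lim: "((\<lambda>z. 2 / cmod z) \<longlongrightarrow> 0) ?F"
    by (rule real_tendsto_divide_at_top[OF tendsto_const])
  \<comment> \<open>At \<open>z = 0\<close> the quotient \<open>2 / cmod z\<close> is 0 by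
    convention and bounds nothing, so the origin is excluded.\<close>
  have pos: "eventually (\<lambda>z. cmod z > 0) ?F"
    using \<open>filterlim cmod at_top ?F\<close> unfolding filterlim_at_top_dense by blast
  have left: "eventually (\<lambda>z. Re z \<le> 0) ?F"
    by (simp add: eventually_inf_principal)
  have "eventually (\<lambda>z. (cmod (R z))\<^sup>2 \<le> 2 / cmod z) ?F"
    using pos left
  proof eventually_elim
    case (elim z)
    then have "2 / stage_denom z \<le> 2 / cmod z"
      using stage_denom_ge(3)[of z] by (intro frac_le) simp_all
    then show ?case using bound[of z] elim by linarith
  qed
  then have "((\<lambda>z. (cmod (R z))\<^sup>2) \<longlongrightarrow> 0) ?F"
    by (intro tendsto_sandwich[OF _ _ tendsto_const lim]) simp_all
  then have "(R \<longlongrightarrow> 0) ?F"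
    by (simp add: tendsto_norm_zero_iff)
  then show ?thesis
    using assms(1) by (simp add: L_stable_def A_stable_def)
qed

lemma L_stable_SI1_1: "L_stable R_SI1_1"
proof (rule L_stableI)
  fix z :: complex
  assume z: "Re z \<le> 0"
  let ?d = "stage_denom z"
  note d = stage_denom_ge[OF z]
  have sq: "(cmod (R_SI1_1 z))\<^sup>2 = (1 + (Im z)\<^sup>2) / ?d\<^sup>2"
    unfolding R_SI1_1_def stage_denom_def[symmetric]
    by (simp add: norm_divide power_divide cmod_power2)
  have "1 + (Im z)\<^sup>2 \<le> (1 + (Im z)\<^sup>2 / 2)\<^sup>2"
    by (simp add: power2_sum)
  also have "\<dots> \<le> ?d\<^sup>2"
    using d(1) by (intro power_mono) simp_all
  finally have "(cmod (R_SI1_1 z))\<^sup>2 \<le> 1"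
    unfolding sq using d(2) by simp
  then show "cmod (R_SI1_1 z) \<le> 1"
    by (simp add: power_le_one_iff)
  have "(1 + (Im z)\<^sup>2) / ?d\<^sup>2 \<le> (2 * ?d) / ?d\<^sup>2"
    using d(1) by (intro divide_right_mono) simp_all
  also have "\<dots> = 2 / ?d"
    by (simp add: power2_eq_square)
  finally show "(cmod (R_SI1_1 z))\<^sup>2 \<le> 2 / ?d"
    unfolding sq .
qed

lemma cmod_R_SI1_2_le:
  assumes "Re z \<le> 0"
  shows "cmod (R_SI1_2 z) \<le> 1 / stage_denom z"
proof -
  define d where "d = stage_denom z"
  define s where "s = (Im z)\<^sup>2"
  have d: "d \<ge> 1 + s / 2" "d \<ge> 1" and s: "s \<ge> 0"
    using stage_denom_ge[OF assms] by (simp_all add: d_def s_def)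
  let ?n = "1 + \<i> * of_real (Im z) * R_SI1_1 z"
  have n: "?n = Complex (1 - s / d) (Im z / d)"
    unfolding R_SI1_1_def stage_denom_def[symmetric] d_def[symmetric] s_def
    using d(2) by (simp add: complex_eq_iff power2_eq_square)
  \<comment> \<open>In \<open>(1 - s / d)\<^sup>2 + s / d\<^sup>2\<close> the cross term
    \<open>- 2 * s / d\<close> has to absorb both \<open>s\<^sup>2 / d\<^sup>2\<close> and
    \<open>s / d\<^sup>2\<close>. It does so since
    \<open>1 + s \<le> 2 + s \<le> 2 * d\<close>.\<close>
  have "s * (1 + s) \<le> s * (2 * d)"
    using d s by (intro mult_left_mono) simp_all
  then have "s * (1 + s) / d\<^sup>2 \<le> s * (2 * d) / d\<^sup>2"
    by (intro divide_right_mono) simp_all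
  also have "\<dots> = 2 * (s / d)"
    using d(2) by (simp add: power2_eq_square)
  finally have "(1 - s / d)\<^sup>2 + s / d\<^sup>2 \<le> 1"
    by (simp add: power2_eq_square algebra_simps add_divide_distrib)
  then have "(cmod ?n)\<^sup>2 \<le> 1"
    unfolding n by (simp add: cmod_power2 power_divide s_def)
  then have "cmod ?n \<le> 1"
    by (simp add: power_le_one_iff)
  then show ?thesis
    unfolding R_SI1_2_def stage_denom_def[symmetric] d_def[symmetric]
    using d(2) by (simp add: norm_divide divide_right_mono)
qed

lemma L_stable_SI1_2: "L_stable R_SI1_2"
proof (rule L_stableI)
  fix z :: complex
  assume z: "Re z \<le> 0"
  let ?r = "cmod (R_SI1_2 z)"
  have r: "?r \<le> 1 / stage_denom z" and d: "stage_denom z \<ge> 1"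
    using cmod_R_SI1_2_le[OF z] stage_denom_ge(2)[OF z] by simp_all
  have "1 / stage_denom z \<le> 1"
    using d by simp
  with r show "?r \<le> 1" by linarith
  \<comment> \<open>The decay like \<open>1 / stage_denom z\<close> is stronger than the shared
    criterion asks for; squaring a number in [0, 1] only decreases it.\<close>
  then have "?r\<^sup>2 \<le> ?r"
    by (simp add: power2_eq_square mult_left_le)
  also note r
  also have "1 / stage_denom z \<le> 2 / stage_denom z"
    using d by (intro divide_right_mono) simp_all
  finally show "?r\<^sup>2 \<le> 2 / stage_denom z" .
qed

theorem proposition1:
  shows "is_stability_function SI1_1 R_SI1_1 \<and> L_stable R_SI1_1 \<and>
         is_stability_function SI1_2 R_SI1_2 \<and> L_stable R_SI1_2"
  by (intro conjI stability_function_SI1_1 L_stable_SI1_1 stability_function_SI1_2 L_stable_SI1_2)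

end
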